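(* Let $\mathcal{B}$ be a bialgebra and let $(C_n)_{n\ge0}$ be the cochain complex $C_n=\{f:\mathcal{B}^{\otimes n}\to\mathbb{C}\mid f\text{ linear}\}$ with coboundary operators $\partial_n:C_n\to C_{n+1}$, $$\partial_n f(a_1,\dots,a_{n+1})=\delta(a_1)f(a_2,\dots,a_{n+1})+\sum_{i=1}^n(-1)^i f(a_1,\dots,a_ia_{i+1},\dots,a_{n+1})+(-1)^{n+1}f(a_1,\dots,a_n)\delta(a_{n+1}).$$ Then $(C_n^{(\mathbf N)})_{n\ge 0}$ and $(C_n^{(\mathbf C)})_{n\ge 0}$ and, if $\mathcal{B}$ is a $*$-bialgebra, $(C_n^{(\mathbf H)})_{n\ge 0}$ are subcomplexes of $(C_n)_{n\ge 0}$.
   Context: All vector spaces are over $\mathbb{C}$. $(\mathcal{B},\mu,\mathbf 1,\Delta,\delta)$: multiplication, unit, comultiplication, counit. $\mathcal{B}^{\otimes0}=\mathbb{C}$. $f(a_1,\dots,a_n)$ means $f(a_1\otimes\dots\otimes a_n)$. $\mu^{(n)}:\mathcal{B}^{\otimes n}\to\mathcal{B}$ is the multiplication of $n$ factors, $\mu^{(0)}(\lambda)=\lambda\mathbf 1$. With $\mathcal{B}^{\otimes n}$ carrying its tensor product coalgebra structure, for $f\in C_n$: $(f\star\mu^{(n)})(a_1\otimes\dots\otimes a_n)=f(a_1^{(1)}\otimes\dots\otimes a_n^{(1)})\,a_1^{(2)}\cdots a_n^{(2)}$ and $(\mu^{(n)}\star f)(a_1\otimes\dots\otimes a_n)=a_1^{(1)}\cdots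 a_n^{(1)}\,f(a_1^{(2)}\otimes\dots\otimes a_n^{(2)})$, where $\Delta a_i=a_i^{(1)}\otimes a_i^{(2)}$ (Sweedler). $C_n^{(\mathbf N)}=\{f\in C_n\mid f(\mathbf 1^{\otimes n})=0\}$; $C_n^{(\mathbf C)}=\{f\in C_n\mid f\star\mu^{(n)}=\mu^{(n)}\star f\}$. A $*$-bialgebra is a bialgebra with an involution $*$ making $\mathcal{B}$ a unital $*$-algebra such that $\Delta,\delta$ are $*$-homomorphisms, where $(a\otimes b)^*=a^*\otimes b^*$. For a $*$-bialgebra and $f\in C_n$ put $\widetilde f(a_1\otimes\dots\otimes a_n)=\overline{f(a_n^*\otimes\dots\otimes a_1^* )}$ (for $n=0$: $\widetilde f(\lambda)=\overline{f(\overline\lambda)}$). $C_n^{(\mathbf H)}=\{f\in C_n\mid\widetilde f=f\}$ if $\lceil n/2\rceil$ is odd ($n=1,2,5,6,\dots$), and $C_n^{(\mathbf H)}=\{f\in C_n\mid\widetilde f=-f\}$ if $\lceil n/2\rceil$ is even ($n=0,3,4,7,8,\dots$). A sequence $(D_n)_n$ of subspaces $D_n\subseteq C_n$ is a subcomplex if $\partial_nD_n\subseteq D_{n+1}$ for all $n$; for $C_n^{(\mathbf H)}$, subspace is understood over $\mathbb{R}$. *)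

theory Defs
  imports Complex_Main "HOL-Library.Function_Algebras" "HOL-Library.Poly_Mapping"
begin

section \<open>Complex vector spaces and unital complex algebras\<close>

class complex_vector = ab_group_add +
  fixes scaleC :: "complex \<Rightarrow> 'a \<Rightarrow> 'a" (infixr "*\<^sub>C" 75)
  assumes scaleC_add_right: "c *\<^sub>C (x + y) = c *\<^sub>C x + c *\<^sub>C y"
    and scaleC_add_left: "(c + d) *\<^sub>C x = c *\<^sub>C x + d *\<^sub>C x"
    and scaleC_scaleC: "c *\<^sub>C d *\<^sub>C x = (c * d) *\<^sub>C x"
    and scaleC_one: "1 *\<^sub>C x = x"

text \<open>The law \<open>0 \<noteq> 1\<close> of \<^class>\<open>ring_1\<close> is no restriction for bialgebras,
  since the counit maps \<open>1\<close> to \<open>1\<close> and is linear.\<close>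

class complex_algebra_1 = complex_vector + ring_1 +
  assumes scaleC_mult_left: "(c *\<^sub>C x) * y = c *\<^sub>C (x * y)"
    and scaleC_mult_right: "x * (c *\<^sub>C y) = c *\<^sub>C (x * y)"

global_interpretation complex_vector: vector_space "scaleC :: complex \<Rightarrow> 'a \<Rightarrow> 'a::complex_vector"
  by unfold_locales (simp_all add: scaleC_add_right scaleC_add_left scaleC_scaleC scaleC_one)

abbreviation clinear :: "('a::complex_vector \<Rightarrow> 'b::complex_vector) \<Rightarrow> bool"
  where "clinear \<equiv> Vector_Spaces.linear scaleC scaleC"

instantiation complex :: complex_algebra_1
begin
definition scaleC_complex :: "complex \<Rightarrow> complex \<Rightarrow> complex"
  where "scaleC_complex c x = c * x"
instance by standard (simp_all add: scaleC_complex_def algebra_simps)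
end

instantiation "fun" :: (type, complex_vector) complex_vector
begin
definition scaleC_fun :: "complex \<Rightarrow> ('a \<Rightarrow> 'b) \<Rightarrow> 'a \<Rightarrow> 'b"
  where "scaleC_fun c f = (\<lambda>x. c *\<^sub>C f x)"
instance
  by standard (simp_all add: scaleC_fun_def fun_eq_iff scaleC_add_right scaleC_add_left
      scaleC_scaleC)
end

instantiation poly_mapping :: (type, complex_vector) complex_vector
begin
definition scaleC_poly_mapping :: "complex \<Rightarrow> ('a \<Rightarrow>\<^sub>0 'b) \<Rightarrow> 'a \<Rightarrow>\<^sub>0 'b"
  where "scaleC_poly_mapping c = Poly_Mapping.map (scaleC c)"
lemma lookup_scaleC [simp]:
  "Poly_Mapping.lookup (c *\<^sub>C p) k = c *\<^sub>C Poly_Mapping.lookup p k"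
  by (simp add: scaleC_poly_mapping_def map.rep_eq when_def)

instance
  by standard (rule poly_mapping_eqI;
      simp add: lookup_add scaleC_add_right scaleC_add_left scaleC_scaleC)+
end


section \<open>Tensor powers\<close>

text \<open>\<open>'a tensor\<close> is \<open>T('a) = \<Oplus>\<^sub>n 'a\<^sup>\<otimes>\<^sup>n\<close>: the complex vector space freely spanned by the
  lists over \<open>'a\<close>, modulo the relations that make \<open>[a\<^sub>1, \<dots>, a\<^sub>n] \<mapsto> a\<^sub>1 \<otimes> \<dots> \<otimes> a\<^sub>n\<close> linear in each
  entry. The relations only involve lists of equal length, so the \<open>n\<close>-fold tensor
  power is the span \<open>tpow n\<close> of the classes of the lists of length \<open>n\<close>; the empty list is the
  unit of \<open>'a\<^sup>\<otimes>\<^sup>0 = \<complex>\<close>.\<close>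

abbreviation free_gen :: "'a list \<Rightarrow> 'a list \<Rightarrow>\<^sub>0 complex"
  where "free_gen xs \<equiv> Poly_Mapping.single xs 1"

definition tensor_relations :: "('a::complex_vector list \<Rightarrow>\<^sub>0 complex) set" where
  "tensor_relations =
     {free_gen (xs @ (a + b) # ys) - free_gen (xs @ a # ys) - free_gen (xs @ b # ys) | xs a b ys. True}
   \<union> {free_gen (xs @ (c *\<^sub>C a) # ys) - c *\<^sub>C free_gen (xs @ a # ys) | xs c a ys. True}"

definition tensor_rel ::
    "('a::complex_vector list \<Rightarrow>\<^sub>0 complex) \<Rightarrow> ('a list \<Rightarrow>\<^sub>0 complex) \<Rightarrow> bool"
  where "tensor_rel p q \<longleftrightarrow> p - q \<in> complex_vector.span tensor_relations"

lemma equivp_tensor_rel: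
  "equivp (tensor_rel :: ('a::complex_vector list \<Rightarrow>\<^sub>0 complex) \<Rightarrow> _)"
proof (rule equivpI)
  show "reflp (tensor_rel :: ('a list \<Rightarrow>\<^sub>0 complex) \<Rightarrow> _)"
    by (simp add: reflp_def tensor_rel_def complex_vector.span_zero)
  show "symp (tensor_rel :: ('a list \<Rightarrow>\<^sub>0 complex) \<Rightarrow> _)"
    unfolding tensor_rel_def by (rule sympI) (drule complex_vector.span_neg, simp)
  show "transp (tensor_rel :: ('a list \<Rightarrow>\<^sub>0 complex) \<Rightarrow> _)"
    unfolding tensor_rel_def by (rule transpI) (drule (1) complex_vector.span_add, simp)
qed

quotient_type (overloaded) 'a tensor = "'a::complex_vector list \<Rightarrow>\<^sub>0 complex" / tensor_rel
  by (rule equivp_tensor_rel)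

instantiation tensor :: (complex_vector) complex_vector
begin

lift_definition zero_tensor :: "'a tensor" is 0 .

lift_definition plus_tensor :: "'a tensor \<Rightarrow> 'a tensor \<Rightarrow> 'a tensor" is "(+)"
  unfolding tensor_rel_def by (subst add_diff_add) (rule complex_vector.span_add)

lift_definition uminus_tensor :: "'a tensor \<Rightarrow> 'a tensor" is uminus
  unfolding tensor_rel_def by (subst minus_diff_minus) (rule complex_vector.span_neg)

lift_definition minus_tensor :: "'a tensor \<Rightarrow> 'a tensor \<Rightarrow> 'a tensor" is "(-)"
  unfolding tensor_rel_def by (drule (1) complex_vector.span_diff) (simp add: algebra_simps)

lift_definition scaleC_tensor :: "complex \<Rightarrow> 'a tensor \<Rightarrow> 'a tensor" is "scaleC"
  unfolding tensor_rel_def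
  by (simp add: complex_vector.span_scale flip: complex_vector.scale_right_diff_distrib)

instance
proof
  fix a b c :: "'a tensor" and r s :: complex
  note simps = tensor_rel_def complex_vector.span_zero scaleC_add_right scaleC_add_left
    scaleC_scaleC
  show "a + b + c = a + (b + c)" by transfer (simp add: simps add.assoc)
  show "a + b = b + a" by transfer (simp add: simps add.commute)
  show "0 + a = a" by transfer (simp add: simps)
  show "- a + a = 0" by transfer (simp add: simps)
  show "a - b = a + - b" by transfer (simp add: simps)
  show "r *\<^sub>C (a + b) = r *\<^sub>C a + r *\<^sub>C b" by transfer (simp add: simps)
  show "(r + s) *\<^sub>C a = r *\<^sub>C a + s *\<^sub>C a" by transfer (simp add: simps)
  show "r *\<^sub>C s *\<^sub>C a = (r * s) *\<^sub>C a" by transfer (simp add: simps)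
  show "1 *\<^sub>C a = a" by transfer (simp add: simps)
qed

end

lift_definition pure :: "'a::complex_vector list \<Rightarrow> 'a tensor" is free_gen .

definition tpow :: "nat \<Rightarrow> 'a::complex_vector tensor set"
  where "tpow n = complex_vector.span {pure xs | xs. length xs = n}"

text \<open>Extension of a map given on pure tensors. For \<open>\<sigma> = id\<close> this is the linear and for
  \<open>\<sigma> = cnj\<close> the conjugate-linear extension; by \<open>semilift_pure\<close> below it is correct whenever
  \<open>\<phi>\<close> is (conjugate-)linear in each list entry, and it is only used for such \<open>\<phi>\<close>.\<close>

definition free_ext ::
    "(complex \<Rightarrow> complex) \<Rightarrow> ('a list \<Rightarrow> 'b::complex_vector) \<Rightarrow> ('a list \<Rightarrow>\<^sub>0 complex) \<Rightarrow> 'b"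
  where "free_ext \<sigma> \<phi> p = (\<Sum>xs\<in>Poly_Mapping.keys p. \<sigma> (Poly_Mapping.lookup p xs) *\<^sub>C \<phi> xs)"

definition semilift ::
    "(complex \<Rightarrow> complex) \<Rightarrow> ('a::complex_vector list \<Rightarrow> 'b::complex_vector) \<Rightarrow> 'a tensor \<Rightarrow> 'b"
  where "semilift \<sigma> \<phi> t = free_ext \<sigma> \<phi> (rep_tensor t)"

abbreviation tlift :: "('a::complex_vector list \<Rightarrow> 'b::complex_vector) \<Rightarrow> 'a tensor \<Rightarrow> 'b"
  where "tlift \<equiv> semilift id"

definition multi_semilinear ::
    "(complex \<Rightarrow> complex) \<Rightarrow> ('a::complex_vector list \<Rightarrow> 'b::complex_vector) \<Rightarrow> bool"
  where "multi_semilinear \<sigma> \<phi> \<longleftrightarrow>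
     (\<forall>xs a b ys. \<phi> (xs @ (a + b) # ys) = \<phi> (xs @ a # ys) + \<phi> (xs @ b # ys)) \<and>
     (\<forall>xs c a ys. \<phi> (xs @ (c *\<^sub>C a) # ys) = \<sigma> c *\<^sub>C \<phi> (xs @ a # ys))"

locale scalar_hom =
  fixes \<sigma> :: "complex \<Rightarrow> complex"
  assumes hom_add: "\<sigma> (c + d) = \<sigma> c + \<sigma> d"
    and hom_mult: "\<sigma> (c * d) = \<sigma> c * \<sigma> d"
    and hom_one: "\<sigma> 1 = 1"
begin

lemma hom_zero: "\<sigma> 0 = 0"
  using hom_add[of 0 0] by simp

lemma free_ext_superset:
  assumes "finite S" "Poly_Mapping.keys p \<subseteq> S"
  shows "free_ext \<sigma> \<phi> p = (\<Sum>xs\<in>S. \<sigma> (Poly_Mapping.lookup p xs) *\<^sub>C \<phi> xs)"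
  unfolding free_ext_def using assms
  by (intro sum.mono_neutral_left) (auto simp: in_keys_iff hom_zero)

lemma free_ext_add: "free_ext \<sigma> \<phi> (p + q) = free_ext \<sigma> \<phi> p + free_ext \<sigma> \<phi> q"
proof -
  let ?S = "Poly_Mapping.keys p \<union> Poly_Mapping.keys q"
  have "Poly_Mapping.keys (p + q) \<subseteq> ?S" by (rule keys_add)
  then show ?thesis
    by (simp add: free_ext_superset[of ?S] lookup_add hom_add scaleC_add_left sum.distrib)
qed

lemma free_ext_scaleC: "free_ext \<sigma> \<phi> (c *\<^sub>C p) = \<sigma> c *\<^sub>C free_ext \<sigma> \<phi> p"
proof -
  let ?S = "Poly_Mapping.keys p"
  have "Poly_Mapping.keys (c *\<^sub>C p) \<subseteq> ?S"
    by (auto simp: in_keys_iff scaleC_complex_def)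
  then show ?thesis
    by (simp add: free_ext_superset[of ?S] hom_mult scaleC_complex_def
        complex_vector.scale_sum_right scaleC_scaleC)
qed

lemma free_ext_diff: "free_ext \<sigma> \<phi> (p - q) = free_ext \<sigma> \<phi> p - free_ext \<sigma> \<phi> q"
  using free_ext_add[of \<phi> "p - q" q] by simp

lemma free_ext_gen: "free_ext \<sigma> \<phi> (free_gen xs) = \<phi> xs"
  by (simp add: free_ext_def hom_one)

lemma free_ext_relations:
  assumes "multi_semilinear \<sigma> \<phi>" "p \<in> complex_vector.span tensor_relations"
  shows "free_ext \<sigma> \<phi> p = 0"
  using assms(2)
proof (induction rule: complex_vector.span_induct_alt)
  case base
  show ?case by (simp add: free_ext_def)
next
  case (step c x y)
  have "free_ext \<sigma> \<phi> x = 0"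
    using step(1) assms(1) unfolding tensor_relations_def multi_semilinear_def
    by (auto simp: free_ext_diff free_ext_scaleC free_ext_gen)
  with step show ?case by (simp add: free_ext_add free_ext_scaleC)
qed

lemma semilift_abs:
  assumes "multi_semilinear \<sigma> \<phi>"
  shows "semilift \<sigma> \<phi> (abs_tensor p) = free_ext \<sigma> \<phi> p"
proof -
  have "tensor_rel (rep_tensor (abs_tensor p)) p"
    by (rule Quotient3_rep_abs[OF Quotient3_tensor equivp_reflp[OF equivp_tensor_rel]])
  then have "free_ext \<sigma> \<phi> (rep_tensor (abs_tensor p) - p) = 0"
    unfolding tensor_rel_def by (rule free_ext_relations[OF assms])
  then show ?thesis
    by (simp add: semilift_def free_ext_diff)
qed

lemma semilift_pure:
  assumes "multi_semilinear \<sigma> \<phi>"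
  shows "semilift \<sigma> \<phi> (pure xs) = \<phi> xs"
  by (simp add: pure.abs_eq semilift_abs[OF assms] free_ext_gen)

lemma semilift_add:
  assumes "multi_semilinear \<sigma> \<phi>"
  shows "semilift \<sigma> \<phi> (s + t) = semilift \<sigma> \<phi> s + semilift \<sigma> \<phi> t"
proof -
  obtain p q where "s = abs_tensor p" "t = abs_tensor q"
    using Quotient3_abs_rep[OF Quotient3_tensor, symmetric] by blast
  then show ?thesis
    by (simp add: plus_tensor.abs_eq semilift_abs[OF assms] free_ext_add)
qed

lemma semilift_scaleC:
  assumes "multi_semilinear \<sigma> \<phi>"
  shows "semilift \<sigma> \<phi> (c *\<^sub>C t) = \<sigma> c *\<^sub>C semilift \<sigma> \<phi> t"
proof -
  obtain p where "t = abs_tensor p"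
    using Quotient3_abs_rep[OF Quotient3_tensor, symmetric] by blast
  then show ?thesis
    by (simp add: scaleC_tensor.abs_eq semilift_abs[OF assms] free_ext_scaleC)
qed

end

global_interpretation scalar_id: scalar_hom id
  by unfold_locales simp_all

global_interpretation scalar_cnj: scalar_hom cnj
  by unfold_locales simp_all

text \<open>The canonical map \<open>'a\<^sup>\<otimes>\<^sup>m \<times> 'a\<^sup>\<otimes>\<^sup>n \<rightarrow> 'a\<^sup>\<otimes>\<^sup>(\<^sup>m\<^sup>+\<^sup>n\<^sup>)\<close>, i.e. the product of the tensor algebra.\<close>

definition tprod :: "'a::complex_vector tensor \<Rightarrow> 'a tensor \<Rightarrow> 'a tensor" (infixr "\<otimes>" 75)
  where "s \<otimes> t = tlift (\<lambda>xs. tlift (\<lambda>ys. pure (xs @ ys)) t) s"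

text \<open>The linear map \<open>'a \<otimes> 'a \<rightarrow> 'b\<close> induced by a bilinear map.\<close>

definition tlift2 :: "('a::complex_vector \<Rightarrow> 'a \<Rightarrow> 'b::complex_vector) \<Rightarrow> 'a tensor \<Rightarrow> 'b"
  where "tlift2 \<beta> = tlift (\<lambda>zs. if length zs = 2 then \<beta> (zs ! 0) (zs ! 1) else 0)"


section \<open>Bialgebras\<close>

definition tmult2 :: "'a::complex_algebra_1 tensor \<Rightarrow> 'a tensor \<Rightarrow> 'a tensor"
  where "tmult2 s t = tlift2 (\<lambda>a b. tlift2 (\<lambda>c d. pure [a * c, b * d]) t) s"

locale bialgebra =
  fixes \<Delta> :: "'b::complex_algebra_1 \<Rightarrow> 'b tensor"
    and \<delta> :: "'b \<Rightarrow> complex"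
  assumes comult_linear: "clinear \<Delta>"
    and comult_tpow: "\<Delta> a \<in> tpow 2"
    and counit_linear: "clinear \<delta>"
    and coassoc: "tlift2 (\<lambda>x y. \<Delta> x \<otimes> pure [y]) (\<Delta> a) = tlift2 (\<lambda>x y. pure [x] \<otimes> \<Delta> y) (\<Delta> a)"
    and counit_left: "tlift2 (\<lambda>x y. \<delta> x *\<^sub>C y) (\<Delta> a) = a"
    and counit_right: "tlift2 (\<lambda>x y. \<delta> y *\<^sub>C x) (\<Delta> a) = a"
    and comult_mult: "\<Delta> (a * b) = tmult2 (\<Delta> a) (\<Delta> b)"
    and comult_one: "\<Delta> 1 = pure [1, 1]"
    and counit_mult: "\<delta> (a * b) = \<delta> a * \<delta> b"
    and counit_one: "\<delta> 1 = 1"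

locale star_bialgebra = bialgebra \<Delta> \<delta>
  for \<Delta> :: "'b::complex_algebra_1 \<Rightarrow> 'b tensor" and \<delta> :: "'b \<Rightarrow> complex" +
  fixes star :: "'b \<Rightarrow> 'b"
  assumes star_star: "star (star a) = a"
    and star_add: "star (a + b) = star a + star b"
    and star_scaleC: "star (c *\<^sub>C a) = cnj c *\<^sub>C star a"
    and star_mult: "star (a * b) = star b * star a"
    and comult_star: "\<Delta> (star a) = semilift cnj (\<lambda>zs. pure (map star zs)) (\<Delta> a)"
    and counit_star: "\<delta> (star a) = cnj (\<delta> a)"

definition tensor_mu :: "'b::complex_algebra_1 tensor \<Rightarrow> 'b"
  where "tensor_mu = tlift prod_list"

text \<open>Comultiplication of the tensor product coalgebra \<open>'b\<^sup>\<otimes>\<^sup>n\<close>, with values in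
  \<open>'b\<^sup>\<otimes>\<^sup>n \<otimes> 'b\<^sup>\<otimes>\<^sup>n = 'b\<^sup>\<otimes>\<^sup>2\<^sup>n\<close>: first form \<open>\<Delta> a\<^sub>1 \<otimes> \<dots> \<otimes> \<Delta> a\<^sub>n\<close>, then
  move the first legs (even positions, counted from \<open>0\<close>) in front of the second legs.\<close>

definition unshuffle :: "nat \<Rightarrow> 'b::complex_vector tensor \<Rightarrow> 'b tensor"
  where "unshuffle n = tlift (\<lambda>zs. if length zs = 2 * n
      then pure (map (\<lambda>i. zs ! (2 * i)) [0..<n] @ map (\<lambda>i. zs ! (2 * i + 1)) [0..<n]) else 0)"

definition comult_pow ::
    "('b::complex_vector \<Rightarrow> 'b tensor) \<Rightarrow> nat \<Rightarrow> 'b tensor \<Rightarrow> 'b tensor"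
  where "comult_pow \<Delta> n = tlift (\<lambda>as. if length as = n
      then unshuffle n (foldr (\<otimes>) (map \<Delta> as) (pure [])) else 0)"

text \<open>Convolution of linear maps \<open>f, g\<close> on \<open>'b\<^sup>\<otimes>\<^sup>n\<close>, whose values are multiplied by
  the bilinear map \<open>\<beta>\<close>.\<close>

definition convolution ::
    "('b::complex_vector \<Rightarrow> 'b tensor) \<Rightarrow> nat \<Rightarrow> ('c \<Rightarrow> 'd \<Rightarrow> 'e::complex_vector) \<Rightarrow>
      ('b tensor \<Rightarrow> 'c) \<Rightarrow> ('b tensor \<Rightarrow> 'd) \<Rightarrow> 'b tensor \<Rightarrow> 'e"
  where "convolution \<Delta> n \<beta> f g t =
      tlift (\<lambda>zs. if length zs = 2 * n then \<beta> (f (pure (take n zs))) (g (pure (drop n zs))) else 0)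
        (comult_pow \<Delta> n t)"


section \<open>The cochain complex and its subcomplexes\<close>

text \<open>A linear functional on \<open>'b\<^sup>\<otimes>\<^sup>n\<close> is represented by its extension to \<open>'b tensor\<close> that
  vanishes on all other tensor powers.\<close>

type_synonym 'b cochain = "'b tensor \<Rightarrow> complex"

definition cochains :: "nat \<Rightarrow> 'b::complex_vector cochain set"
  where "cochains n = {f. clinear f \<and> (\<forall>m. m \<noteq> n \<longrightarrow> (\<forall>t\<in>tpow m. f t = 0))}"

text \<open>With \<open>as = [a\<^sub>1, \<dots>, a\<^sub>n\<^sub>+\<^sub>1]\<close>, the entry \<open>a\<^sub>i\<close> is \<open>as ! (i - 1)\<close>.\<close>

definition coboundary ::
    "('b::complex_algebra_1 \<Rightarrow> complex) \<Rightarrow> nat \<Rightarrow> 'b cochain \<Rightarrow> 'b cochain"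
  where "coboundary \<delta> n f = tlift (\<lambda>as. if length as = n + 1 then
      \<delta> (hd as) * f (pure (tl as))
      + (\<Sum>i=1..n. (-1) ^ i * f (pure (take (i - 1) as @ [as ! (i - 1) * as ! i] @ drop (i + 1) as)))
      + (-1) ^ (n + 1) * f (pure (butlast as)) * \<delta> (last as) else 0)"

text \<open>The scalar multiplication \<open>s\<close> determines the field over which the \<open>D n\<close> are subspaces.\<close>

definition subcomplex ::
    "('k::field \<Rightarrow> 'b::complex_algebra_1 cochain \<Rightarrow> 'b cochain) \<Rightarrow> ('b \<Rightarrow> complex) \<Rightarrow>
      (nat \<Rightarrow> 'b cochain set) \<Rightarrow> bool"
  where "subcomplex s \<delta> D \<longleftrightarrow>
      (\<forall>n. D n \<subseteq> cochains n \<and> module.subspace s (D n) \<and> coboundary \<delta> n ` D n \<subseteq> D (n + 1))"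

definition cochains_N :: "nat \<Rightarrow> 'b::complex_algebra_1 cochain set"
  where "cochains_N n = {f \<in> cochains n. f (pure (replicate n 1)) = 0}"

definition cochains_C ::
    "('b::complex_algebra_1 \<Rightarrow> 'b tensor) \<Rightarrow> nat \<Rightarrow> 'b cochain set"
  where "cochains_C \<Delta> n = {f \<in> cochains n. \<forall>t\<in>tpow n.
      convolution \<Delta> n (\<lambda>c b. c *\<^sub>C b) f tensor_mu t = convolution \<Delta> n (\<lambda>b c. c *\<^sub>C b) tensor_mu f t}"

definition cochain_tilde :: "('b::complex_algebra_1 \<Rightarrow> 'b) \<Rightarrow> 'b cochain \<Rightarrow> 'b cochain"
  where "cochain_tilde star f = tlift (\<lambda>as. cnj (f (pure (map star (rev as)))))"

definition cochains_H :: "('b::complex_algebra_1 \<Rightarrow> 'b) \<Rightarrow> nat \<Rightarrow> 'b cochain set"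
  where "cochains_H star n = {f \<in> cochains n.
      if odd \<lceil>real n / 2\<rceil> then cochain_tilde star f = f else cochain_tilde star f = - f}"

end

theory Submission
  imports Defs
begin

text \<open>A cochain vanishing at \<open>1 \<otimes> \<dots> \<otimes> 1\<close> is treated directly: every one of the \<open>n + 2\<close> terms of
  \<open>\<partial>f(1, \<dots>, 1)\<close> is \<open>\<plusminus>f(1, \<dots>, 1)\<close>.

  For the commuting cochains, the point is that \<open>f \<mapsto> f \<star> \<mu>\<^sup>(\<^sup>n\<^sup>)\<close> turns the coboundary with trivial
  coefficients (both outer actions through \<open>\<delta>\<close>) into the Hochschild coboundary of cochains
  with values in the bialgebra:
  \<open>(\<partial>f \<star> \<mu>)(a\<^sub>1, \<dots>, a\<^sub>n\<^sub>+\<^sub>1) = a\<^sub>1 (f \<star> \<mu>)(a\<^sub>2, \<dots>) + \<Sum>\<^sub>i (-1)\<^sup>i (f \<star> \<mu>)(\<dots>, a\<^sub>i a\<^sub>i\<^sub>+\<^sub>1, \<dots>)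
  + (-1)\<^sup>n\<^sup>+\<^sup>1 (f \<star> \<mu>)(a\<^sub>1, \<dots>, a\<^sub>n) a\<^sub>n\<^sub>+\<^sub>1\<close>.
  The outer terms come from the counit law, the inner ones from multiplicativity of \<open>\<Delta>\<close>
  (\<open>conv_mu_coboundary\<close>). Both properties survive exchanging the two legs of \<open>\<Delta>\<close>, so
  \<open>\<mu> \<star> \<partial>f\<close> is given by the same formula in \<open>\<mu> \<star> f\<close>. Hence
  \<open>f \<star> \<mu> = \<mu> \<star> f\<close> implies \<open>\<partial>f \<star> \<mu> = \<mu> \<star> \<partial>f\<close>.

  For the hermitian cochains, reversing the arguments reverses the order of the terms of \<open>\<partial>\<close>; comparing
  the signs gives that the tilde of \<open>\<partial>\<^sub>n f\<close> is \<open>(-1)\<^sup>n\<^sup>+\<^sup>1\<close> times \<open>\<partial>\<^sub>n\<close> of the tilde of \<open>f\<close>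
  (\<open>tilde_coboundary\<close>), and the sign by which \<open>\<lceil>n/2\<rceil>\<close> defines the hermitian cochains
  changes by the same factor from \<open>n\<close> to \<open>n + 1\<close> (\<open>sign_step\<close>).

  All functionals involved are linear, so everything is checked on pure tensors. There the
  convolutions become finite Sweedler sums, for which every \<open>\<Delta> a\<close> is written once and for all as
  a finite sum of pure tensors.\<close>

section \<open>Multilinear maps and tensors\<close>

lemma clinear_iff:
  "clinear f \<longleftrightarrow> (\<forall>x y. f (x + y) = f x + f y) \<and> (\<forall>c x. f (c *\<^sub>C x) = c *\<^sub>C f x)"
  by (simp add: Vector_Spaces.linear_iff complex_vector.vector_space_axioms)

lemma clinear_add: "clinear f \<Longrightarrow> f (x + y) = f x + f y"
  and clinear_scaleC: "clinear f \<Longrightarrow> f (c *\<^sub>C x) = c *\<^sub>C f x"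
  by (simp_all add: clinear_iff)

lemma clinear_zero: "clinear f \<Longrightarrow> f 0 = 0"
  using clinear_scaleC[of f 0 0] by simp

lemma clinear_sum_list:
  assumes "clinear f"
  shows "f (\<Sum>x\<leftarrow>xs. g x) = (\<Sum>x\<leftarrow>xs. f (g x))"
  by (induction xs) (simp_all add: clinear_zero[OF assms] clinear_add[OF assms])

text \<open>Replacing an entry of a list, rather than splitting the list there, is convenient when the
  entries of the list are permuted before they are tensored.\<close>

lemma multi_semilinear_updateI:
  assumes "\<And>zs i a b. i < length zs \<Longrightarrow> \<phi> (zs[i := a + b]) = \<phi> (zs[i := a]) + \<phi> (zs[i := b])"
    and "\<And>zs i c a. i < length zs \<Longrightarrow> \<phi> (zs[i := c *\<^sub>C a]) = \<sigma> c *\<^sub>C \<phi> (zs[i := a])"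
  shows "multi_semilinear \<sigma> \<phi>"
  unfolding multi_semilinear_def
proof (intro conjI allI)
  fix xs ys and a b :: 'a and c
  show "\<phi> (xs @ (a + b) # ys) = \<phi> (xs @ a # ys) + \<phi> (xs @ b # ys)"
    using assms(1)[of "length xs" "xs @ a # ys" a b] by simp
  show "\<phi> (xs @ (c *\<^sub>C a) # ys) = \<sigma> c *\<^sub>C \<phi> (xs @ a # ys)"
    using assms(2)[of "length xs" "xs @ a # ys" c a] by simp
qed

lemma multi_semilinear_update:
  assumes "multi_semilinear \<sigma> \<phi>" "i < length zs"
  shows "\<phi> (zs[i := a + b]) = \<phi> (zs[i := a]) + \<phi> (zs[i := b])"
    and "\<phi> (zs[i := c *\<^sub>C a]) = \<sigma> c *\<^sub>C \<phi> (zs[i := a])"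
  using assms by (simp_all add: upd_conv_take_nth_drop multi_semilinear_def)

lemma multi_semilinear_if_length:
  assumes "\<And>xs a b ys. length xs + length ys + 1 = n \<Longrightarrow>
      \<phi> (xs @ (a + b) # ys) = \<phi> (xs @ a # ys) + \<phi> (xs @ b # ys)"
    and "\<And>xs c a ys. length xs + length ys + 1 = n \<Longrightarrow>
      \<phi> (xs @ (c *\<^sub>C a) # ys) = \<sigma> c *\<^sub>C \<phi> (xs @ a # ys)"
  shows "multi_semilinear \<sigma> (\<lambda>zs. if length zs = n then \<phi> zs else 0)"
  using assms by (auto simp: multi_semilinear_def)

lemma multi_semilinear_pure: "multi_semilinear id pure"
  unfolding multi_semilinear_def
proof (intro conjI allI)
  fix xs ys and a b :: 'a and c
  show "pure (xs @ (a + b) # ys) = pure (xs @ a # ys) + pure (xs @ b # ys)"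
    by transfer (unfold tensor_rel_def tensor_relations_def diff_diff_eq[symmetric],
      rule complex_vector.span_base, blast)
  show "pure (xs @ (c *\<^sub>C a) # ys) = id c *\<^sub>C pure (xs @ a # ys)"
    unfolding id_apply
    by transfer (unfold tensor_rel_def tensor_relations_def,
      rule complex_vector.span_base, blast)
qed

lemmas pure_add = multi_semilinear_pure[unfolded multi_semilinear_def, THEN conjunct1, rule_format]
lemmas pure_scaleC =
  multi_semilinear_pure[unfolded multi_semilinear_def id_apply, THEN conjunct2, rule_format]
lemmas pure_update = multi_semilinear_update[OF multi_semilinear_pure, unfolded id_apply]

lemma semilift_clinear: "multi_semilinear id \<phi> \<Longrightarrow> clinear (tlift \<phi>)"
  by (simp add: clinear_iff scalar_id.semilift_add scalar_id.semilift_scaleC)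

lemma semilift_fun_add:
  "semilift \<sigma> (\<lambda>xs. \<phi> xs + \<psi> xs) t = semilift \<sigma> \<phi> t + semilift \<sigma> \<psi> t"
  by (simp add: semilift_def free_ext_def scaleC_add_right sum.distrib)

lemma semilift_fun_scaleC: "semilift \<sigma> (\<lambda>xs. c *\<^sub>C \<phi> xs) t = c *\<^sub>C semilift \<sigma> \<phi> t"
  by (simp add: semilift_def free_ext_def complex_vector.scale_sum_right scaleC_scaleC mult.commute)

lemma semilift_fun_zero: "semilift \<sigma> (\<lambda>xs. 0) t = 0"
  by (simp add: semilift_def free_ext_def)

text \<open>A functional on the whole tensor algebra is determined by its values on pure tensors; this is
  what reduces identities of cochains to identities in list arguments.\<close>

lemma span_range_pure: "t \<in> complex_vector.span (range pure)"
proof -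
  have "abs_tensor p \<in> complex_vector.span (range pure)" for p :: "'a list \<Rightarrow>\<^sub>0 complex"
  proof (induction p rule: Poly_Mapping.update_induct)
    case const
    show ?case by (metis zero_tensor.abs_eq complex_vector.span_zero)
  next
    case (update p xs c)
    have "Poly_Mapping.update xs c p = p + c *\<^sub>C free_gen xs"
      using update(1)
      by (intro poly_mapping_eqI)
        (auto simp: lookup_update lookup_add lookup_single when_def scaleC_complex_def in_keys_iff)
    then have "abs_tensor (Poly_Mapping.update xs c p) = abs_tensor p + c *\<^sub>C pure xs"
      by (simp add: plus_tensor.abs_eq scaleC_tensor.abs_eq pure.abs_eq)
    with update(3) show ?case
      by (simp add: complex_vector.span_base complex_vector.span_scale complex_vector.span_add)
  qed
  then show ?thesis by (metis Quotient3_abs_rep[OF Quotient3_tensor])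
qed

lemma clinear_eq_on_span:
  assumes "clinear f" "clinear g" "\<And>x. x \<in> S \<Longrightarrow> f x = g x" "t \<in> complex_vector.span S"
  shows "f t = g t"
  using assms(4)
proof (induction rule: complex_vector.span_induct_alt)
  case base
  show ?case by (simp add: clinear_zero[OF assms(1)] clinear_zero[OF assms(2)])
next
  case (step c x y)
  then show ?case
    by (simp only: clinear_add[OF assms(1)] clinear_add[OF assms(2)] clinear_scaleC[OF assms(1)]
        clinear_scaleC[OF assms(2)] assms(3))
qed

lemma clinear_eqI:
  assumes "clinear f" "clinear g" "\<And>xs. f (pure xs) = g (pure xs)"
  shows "f = g"
proof
  fix t
  show "f t = g t"
    by (rule clinear_eq_on_span[OF assms(1,2) _ span_range_pure]) (use assms(3) in auto)
qed

definition cbilinear ::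
    "('a::complex_vector \<Rightarrow> 'b::complex_vector \<Rightarrow> 'c::complex_vector) \<Rightarrow> bool"
  where "cbilinear \<beta> \<longleftrightarrow> (\<forall>y. clinear (\<lambda>x. \<beta> x y)) \<and> (\<forall>x. clinear (\<beta> x))"

lemma cbilinear_iff: "cbilinear \<beta> \<longleftrightarrow>
    (\<forall>x x' y. \<beta> (x + x') y = \<beta> x y + \<beta> x' y) \<and> (\<forall>c x y. \<beta> (c *\<^sub>C x) y = c *\<^sub>C \<beta> x y) \<and>
    (\<forall>x y y'. \<beta> x (y + y') = \<beta> x y + \<beta> x y') \<and> (\<forall>c x y. \<beta> x (c *\<^sub>C y) = c *\<^sub>C \<beta> x y)"
  by (auto simp: cbilinear_def clinear_iff)

lemma cbilinear_multi:
  assumes "cbilinear \<beta>"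
  shows "multi_semilinear id (\<lambda>zs. if length zs = 2 then \<beta> (zs ! 0) (zs ! 1) else 0)"
proof (rule multi_semilinear_if_length)
  fix xs ys :: "'a list" and a b :: 'a and c
  assume "length xs + length ys + 1 = 2"
  then consider y where "xs = []" "ys = [y]" | x where "xs = [x]" "ys = []"
    by (cases xs; cases ys) auto
  then show "\<beta> ((xs @ (a + b) # ys) ! 0) ((xs @ (a + b) # ys) ! 1)
      = \<beta> ((xs @ a # ys) ! 0) ((xs @ a # ys) ! 1) + \<beta> ((xs @ b # ys) ! 0) ((xs @ b # ys) ! 1)"
    "\<beta> ((xs @ (c *\<^sub>C a) # ys) ! 0) ((xs @ (c *\<^sub>C a) # ys) ! 1)
      = id c *\<^sub>C \<beta> ((xs @ a # ys) ! 0) ((xs @ a # ys) ! 1)"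
    by (cases; use assms in \<open>simp add: cbilinear_iff\<close>)+
qed

lemma tlift2_pure: "cbilinear \<beta> \<Longrightarrow> tlift2 \<beta> (pure [x, y]) = \<beta> x y"
  by (simp add: tlift2_def scalar_id.semilift_pure[OF cbilinear_multi])

lemma tlift2_clinear: "cbilinear \<beta> \<Longrightarrow> clinear (tlift2 \<beta>)"
  unfolding tlift2_def by (intro semilift_clinear cbilinear_multi)

lemma tlift2_fun_add: "tlift2 (\<lambda>x y. \<beta> x y + \<gamma> x y) t = tlift2 \<beta> t + tlift2 \<gamma> t"
  unfolding tlift2_def semilift_fun_add[symmetric]
  by (rule arg_cong[where f = "\<lambda>\<phi>. tlift \<phi> t"]) auto

lemma tlift2_fun_scaleC: "tlift2 (\<lambda>x y. c *\<^sub>C \<beta> x y) t = c *\<^sub>C tlift2 \<beta> t"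
  unfolding tlift2_def semilift_fun_scaleC[symmetric]
  by (rule arg_cong[where f = "\<lambda>\<phi>. tlift \<phi> t"]) auto

lemma pure2:
  "pure [x + x', y] = pure [x, y] + pure [x', y]" "pure [c *\<^sub>C x, y] = c *\<^sub>C pure [x, y]"
  "pure [x, y + y'] = pure [x, y] + pure [x, y']" "pure [x, c *\<^sub>C y] = c *\<^sub>C pure [x, y]"
  using pure_add[of "[]" x x' "[y]"] pure_scaleC[of "[]" c x "[y]"]
    pure_add[of "[x]" y y' "[]"] pure_scaleC[of "[x]" c y "[]"] by simp_all

lemma tprod_inner: "multi_semilinear id (\<lambda>ys. pure (xs @ ys))"
  unfolding multi_semilinear_def id_apply
  by (simp add: append_assoc[symmetric] pure_add pure_scaleC del: append_assoc)

lemma tprod_outer: "multi_semilinear id (\<lambda>xs. tlift (\<lambda>ys. pure (xs @ ys)) t)"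
  unfolding multi_semilinear_def id_apply
  by (simp add: pure_add pure_scaleC semilift_fun_add semilift_fun_scaleC)

lemma tprod_pure: "pure xs \<otimes> pure ys = pure (xs @ ys)"
  unfolding tprod_def scalar_id.semilift_pure[OF tprod_outer]
  by (rule scalar_id.semilift_pure[OF tprod_inner])

lemma tprod_clinear_left: "clinear (\<lambda>s. s \<otimes> t)"
  unfolding tprod_def by (rule semilift_clinear[OF tprod_outer])

lemma tprod_clinear_right: "clinear (\<lambda>t. s \<otimes> t)"
  by (simp add: tprod_def clinear_iff scalar_id.semilift_add scalar_id.semilift_scaleC tprod_inner
      semilift_fun_add semilift_fun_scaleC)

lemma prod_list_multi: "multi_semilinear id (prod_list :: 'b::complex_algebra_1 list \<Rightarrow> 'b)"
  by (simp add: multi_semilinear_def distrib_left distrib_right scaleC_mult_left scaleC_mult_right)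

lemma tensor_mu_pure: "tensor_mu (pure xs) = prod_list xs"
  by (simp add: tensor_mu_def scalar_id.semilift_pure[OF prod_list_multi])

lemma unshuffle_multi: "multi_semilinear id (\<lambda>zs. if length zs = 2 * n
    then pure (map (\<lambda>i. zs ! (2 * i)) [0..<n] @ map (\<lambda>i. zs ! (2 * i + 1)) [0..<n]) else 0)"
proof -
  define P where "P zs = map (\<lambda>i. zs ! (2 * i)) [0..<n] @ map (\<lambda>i. zs ! (2 * i + 1)) [0..<n]"
    for zs :: "'a list"
  define j where "j i = (if even i then i div 2 else n + i div 2)" for i
  have P: "P (zs[i := a]) = (P zs)[j i := a]" if "length zs = 2 * n" "i < length zs" for zs i a
    by (rule nth_equalityI)
      (use that in \<open>auto simp: P_def j_def nth_append nth_list_update elim!: evenE oddE\<close>)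
  have j: "j i < length (P zs)" if "length zs = 2 * n" "i < length zs" for zs i
    using that by (auto simp: P_def j_def)
  show ?thesis
    unfolding P_def[symmetric]
    by (rule multi_semilinear_updateI) (auto simp: P j pure_update)
qed

lemma unshuffle_splice:
  assumes "length xs = n" "length ys = n"
  shows "unshuffle n (pure (splice xs ys)) = pure (xs @ ys)"
proof -
  have "map (\<lambda>i. splice xs ys ! (2 * i)) [0..<n] = xs \<and>
      map (\<lambda>i. splice xs ys ! (2 * i + 1)) [0..<n] = ys"
    using assms
  proof (induction n arbitrary: xs ys)
    case (Suc n)
    then obtain x xs' y ys' where "xs = x # xs'" "ys = y # ys'" 
      by (metis length_Suc_conv)
    with Suc show ?case by (simp add: map_upt_Suc del: upt_Suc)
  qed simp
  then show ?thesis
    using assms by (simp add: unshuffle_def scalar_id.semilift_pure[OF unshuffle_multi])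
qed

section \<open>Sweedler sums\<close>

text \<open>A chosen finite presentation of \<open>\<Delta> a\<close>, the summation indices of Sweedler notation. The coefficients
  of the pure tensors are absorbed into the first legs. The choice is neither linear nor
  multiplicative in \<open>a\<close>; only sums of bilinear expressions over it are.\<close>

definition legs :: "('b::complex_vector \<Rightarrow> 'b tensor) \<Rightarrow> 'b \<Rightarrow> ('b \<times> 'b) list"
  where "legs \<Delta> a = (SOME ps. \<Delta> a = (\<Sum>(x, y)\<leftarrow>ps. pure [x, y]))"

text \<open>The sum of \<open>B [a\<^sub>1', \<dots>, a\<^sub>n'] [a\<^sub>1'', \<dots>, a\<^sub>n'']\<close> in Sweedler notation, with the legs listed by \<open>L\<close>.
  Keeping \<open>L\<close> arbitrary allows the legs to be exchanged.\<close>

primrec sweedler_sum :: "('b \<Rightarrow> ('b \<times> 'b) list) \<Rightarrow> 'b list \<Rightarrow>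
    ('b list \<Rightarrow> 'b list \<Rightarrow> 'c::comm_monoid_add) \<Rightarrow> 'c" where
  "sweedler_sum L [] B = B [] []"
| "sweedler_sum L (a # as) B = (\<Sum>(x, y)\<leftarrow>L a. sweedler_sum L as (\<lambda>xs ys. B (x # xs) (y # ys)))"

lemma tpow_two_list:
  assumes "t \<in> tpow 2"
  shows "\<exists>ps. t = (\<Sum>(x, y)\<leftarrow>ps. pure [x, y])"
  using assms unfolding tpow_def
proof (induction rule: complex_vector.span_induct_alt)
  case base
  show ?case by (rule exI[of _ "[]"]) simp
next
  case (step c s t)
  then obtain x y ps where s: "s = pure [x, y]" and "t = (\<Sum>(x, y)\<leftarrow>ps. pure [x, y])"
    by (auto simp: length_Suc_conv numeral_2_eq_2)
  then show ?case
    by (intro exI[of _ "(c *\<^sub>C x, y) # ps"]) (simp add: pure2)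
qed

lemma sum_list_cong: "(\<And>x. x \<in> set xs \<Longrightarrow> f x = g x) \<Longrightarrow> (\<Sum>x\<leftarrow>xs. f x) = (\<Sum>x\<leftarrow>xs. g x)"
  by (metis map_eq_conv)

lemma sweedler_sum_cong:
  assumes "\<And>xs ys. length xs = length as \<Longrightarrow> length ys = length as \<Longrightarrow> B xs ys = C xs ys"
  shows "sweedler_sum L as B = sweedler_sum L as C"
  using assms
proof (induction as arbitrary: B C)
  case (Cons a as)
  show ?case
    by (auto intro!: sum_list_cong Cons.IH Cons.prems)
qed simp

lemma sweedler_sum_append: "sweedler_sum L (us @ vs) B =
    sweedler_sum L us (\<lambda>xs ys. sweedler_sum L vs (\<lambda>xs' ys'. B (xs @ xs') (ys @ ys')))"
  by (induction us arbitrary: B) simp_all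

lemma sweedler_sum_add: "sweedler_sum L as (\<lambda>xs ys. B xs ys + C xs ys)
    = sweedler_sum L as B + sweedler_sum L as C"
  by (induction as arbitrary: B C) (simp_all add: case_prod_unfold sum_list_addf)

lemma sweedler_sum_linear:
  assumes "clinear f"
  shows "f (sweedler_sum L as B) = sweedler_sum L as (\<lambda>xs ys. f (B xs ys))"
  by (induction as arbitrary: B) (simp_all add: case_prod_unfold clinear_sum_list[OF assms])

lemma sweedler_sum_scaleC:
  "sweedler_sum L as (\<lambda>xs ys. c *\<^sub>C B xs ys) = c *\<^sub>C sweedler_sum L as B"
  by (rule sweedler_sum_linear[symmetric])
    (simp add: clinear_iff scaleC_add_right scaleC_scaleC mult.commute)

lemma sweedler_sum_zero: "sweedler_sum L as (\<lambda>xs ys. 0) = 0"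
  by (induction as) (simp_all add: case_prod_unfold)

lemma sweedler_sum_sum:
  "sweedler_sum L as (\<lambda>xs ys. \<Sum>i\<in>I. B i xs ys) = (\<Sum>i\<in>I. sweedler_sum L as (B i))"
  by (induction I rule: infinite_finite_induct) (simp_all add: sweedler_sum_zero sweedler_sum_add)

lemma sweedler_sum_swap: "sweedler_sum (map prod.swap \<circ> L) as B = sweedler_sum L as (\<lambda>xs ys. B ys xs)"
  by (induction as arbitrary: B) (simp_all add: case_prod_unfold comp_def)

section \<open>Comultiplication and convolution on pure tensors\<close>

context bialgebra
begin

lemma comult_legs: "\<Delta> a = (\<Sum>(x, y)\<leftarrow>legs \<Delta> a. pure [x, y])"
  unfolding legs_def by (rule someI_ex[OF tpow_two_list[OF comult_tpow]])

lemma tlift2_comult: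
  assumes "cbilinear \<beta>"
  shows "tlift2 \<beta> (\<Delta> a) = (\<Sum>(x, y)\<leftarrow>legs \<Delta> a. \<beta> x y)"
  by (subst comult_legs)
    (simp add: clinear_sum_list[OF tlift2_clinear[OF assms]] case_prod_unfold tlift2_pure[OF assms])

lemma legs_counit_left: "(\<Sum>(x, y)\<leftarrow>legs \<Delta> a. \<delta> x *\<^sub>C y) = a"
proof -
  have "cbilinear (\<lambda>x y. \<delta> x *\<^sub>C y)"
    using counit_linear by (simp add: cbilinear_def clinear_iff scaleC_add_left scaleC_add_right
        scaleC_scaleC scaleC_complex_def mult.commute)
  from tlift2_comult[OF this] counit_left show ?thesis by metis
qed

lemma legs_counit_right: "(\<Sum>(x, y)\<leftarrow>legs \<Delta> a. \<delta> y *\<^sub>C x) = a"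
proof -
  have "cbilinear (\<lambda>x y. \<delta> y *\<^sub>C x)"
    using counit_linear by (simp add: cbilinear_def clinear_iff scaleC_add_left scaleC_add_right
        scaleC_scaleC scaleC_complex_def mult.commute)
  from tlift2_comult[OF this] counit_right show ?thesis by metis
qed

text \<open>Sums of bilinear expressions over the legs depend only on \<open>\<Delta> (a * b)\<close>, not on its chosen presentation, so
  multiplicativity of \<open>\<Delta>\<close> can be used with the presentation \<open>\<Delta> a \<Delta> b\<close>.\<close>

lemma legs_mult:
  assumes "cbilinear \<beta>"
  shows "(\<Sum>(x, y)\<leftarrow>legs \<Delta> (a * b). \<beta> x y)
    = (\<Sum>(x, y)\<leftarrow>legs \<Delta> a. \<Sum>(x', y')\<leftarrow>legs \<Delta> b. \<beta> (x * x') (y * y'))"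
proof -
  note simps = cbilinear_def clinear_iff pure2 distrib_left distrib_right
    scaleC_mult_left scaleC_mult_right
  have 1: "cbilinear (\<lambda>x' y'. pure [x * x', y * y'])" for x y :: 'b
    by (simp add: simps)
  have 2: "cbilinear (\<lambda>x y. tlift2 (\<lambda>x' y'. pure [x * x', y * y']) t)" for t :: "'b tensor"
    by (simp add: simps tlift2_fun_add tlift2_fun_scaleC)
  have "\<Delta> (a * b) = (\<Sum>(x, y)\<leftarrow>legs \<Delta> a. \<Sum>(x', y')\<leftarrow>legs \<Delta> b. pure [x * x', y * y'])"
    unfolding comult_mult tmult2_def
    by (simp only: tlift2_comult[OF 2]) (simp only: tlift2_comult[OF 1])
  then show ?thesis
    unfolding tlift2_comult[OF assms, symmetric]
    by (simp add: clinear_sum_list[OF tlift2_clinear[OF assms]] case_prod_unfold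
        tlift2_pure[OF assms])
qed

lemma comult_pow_multi: "multi_semilinear id (\<lambda>as. if length as = n
      then unshuffle n (foldr (\<otimes>) (map \<Delta> as) (pure [])) else 0)"
proof -
  have *: "foldr (\<otimes>) (map \<Delta> xs) (s + t) = foldr (\<otimes>) (map \<Delta> xs) s + foldr (\<otimes>) (map \<Delta> xs) t"
    "foldr (\<otimes>) (map \<Delta> xs) (c *\<^sub>C s) = c *\<^sub>C foldr (\<otimes>) (map \<Delta> xs) s" for xs s t c
    by (induction xs) (simp_all add: clinear_add[OF tprod_clinear_right]
        clinear_scaleC[OF tprod_clinear_right])
  have "clinear (unshuffle n :: 'b tensor \<Rightarrow> _)"
    unfolding unshuffle_def by (rule semilift_clinear[OF unshuffle_multi])
  note lin = this comult_linear tprod_clinear_left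
  show ?thesis
    by (intro multi_semilinear_if_length) (simp_all add: lin[THEN clinear_add] lin[THEN clinear_scaleC] *)
qed

text \<open>The tensor product \<open>\<Delta> a\<^sub>1 \<otimes> \<dots> \<otimes> \<Delta> a\<^sub>n\<close> is the Sweedler sum of the interleaved legs, and unshuffling
  undoes the interleaving.\<close>

lemma comult_pow_pure:
  assumes "length as = n"
  shows "comult_pow \<Delta> n (pure as) = sweedler_sum (legs \<Delta>) as (\<lambda>xs ys. pure (xs @ ys))"
proof -
  have "foldr (\<otimes>) (map \<Delta> as) (pure []) = sweedler_sum (legs \<Delta>) as (\<lambda>xs ys. pure (splice xs ys))"
  proof (induction as)
    case (Cons a as)
    have "foldr (\<otimes>) (map \<Delta> (a # as)) (pure []) =
      (\<Sum>(x, y)\<leftarrow>legs \<Delta> a. pure [x, y]) \<otimes> sweedler_sum (legs \<Delta>) as (\<lambda>xs ys. pure (splice xs ys))"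
      by (simp only: Cons comult_legs[symmetric] list.map foldr.simps comp_apply)
    also have "\<dots> = sweedler_sum (legs \<Delta>) (a # as) (\<lambda>xs ys. pure (splice xs ys))"
      unfolding clinear_sum_list[OF tprod_clinear_left]
      by (simp add: sweedler_sum_linear[OF tprod_clinear_right] case_prod_unfold tprod_pure)
    finally show ?case .
  qed simp
  moreover have "clinear (unshuffle n :: 'b tensor \<Rightarrow> _)"
    unfolding unshuffle_def by (rule semilift_clinear[OF unshuffle_multi])
  ultimately show ?thesis
    using assms
    by (simp add: comult_pow_def scalar_id.semilift_pure[OF comult_pow_multi] sweedler_sum_linear)
      (intro sweedler_sum_cong, simp add: unshuffle_splice)
qed

lemma convolution_multi:
  fixes f g :: "'b tensor \<Rightarrow> _"
  assumes "cbilinear \<beta>" "clinear f" "clinear g"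
  shows "multi_semilinear id
    (\<lambda>zs. if length zs = 2 * n then \<beta> (f (pure (take n zs))) (g (pure (drop n zs))) else 0)"
proof (rule multi_semilinear_if_length)
  fix xs ys :: "'b list" and a b :: 'b and c
  have *: "(\<exists>us. \<forall>a. take n (xs @ a # ys) = xs @ a # us \<and> drop n (xs @ a # ys) = drop (n - length xs - 1) ys)
    \<or> (\<exists>us. \<forall>a. drop n (xs @ a # ys) = us @ a # ys \<and> take n (xs @ a # ys) = take n xs)"
    by (cases "length xs < n") (auto simp: take_Cons' drop_Cons')
  show "\<beta> (f (pure (take n (xs @ (a + b) # ys)))) (g (pure (drop n (xs @ (a + b) # ys))))
    = \<beta> (f (pure (take n (xs @ a # ys)))) (g (pure (drop n (xs @ a # ys))))
    + \<beta> (f (pure (take n (xs @ b # ys)))) (g (pure (drop n (xs @ b # ys))))"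
    using * assms by (auto simp: pure_add clinear_iff cbilinear_def)
  show "\<beta> (f (pure (take n (xs @ (c *\<^sub>C a) # ys)))) (g (pure (drop n (xs @ (c *\<^sub>C a) # ys))))
    = id c *\<^sub>C \<beta> (f (pure (take n (xs @ a # ys)))) (g (pure (drop n (xs @ a # ys))))"
    using * assms by (auto simp: pure_scaleC clinear_iff cbilinear_def)
qed

lemma convolution_clinear:
  assumes "cbilinear \<beta>" "clinear f" "clinear g"
  shows "clinear (convolution \<Delta> n \<beta> f g)"
  using semilift_clinear[OF convolution_multi[OF assms]] semilift_clinear[OF comult_pow_multi]
  by (simp add: convolution_def comult_pow_def clinear_iff)

lemma convolution_pure:
  assumes "cbilinear \<beta>" "clinear f" "clinear g" "length as = n"
  shows "convolution \<Delta> n \<beta> f g (pure as) =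
    sweedler_sum (legs \<Delta>) as (\<lambda>xs ys. \<beta> (f (pure xs)) (g (pure ys)))"
proof -
  note multi = convolution_multi[OF assms(1-3), of n]
  show ?thesis
    unfolding convolution_def comult_pow_pure[OF assms(4)] sweedler_sum_linear[OF semilift_clinear[OF multi]]
    using assms(4) by (intro sweedler_sum_cong) (simp add: scalar_id.semilift_pure[OF multi])
qed

end

section \<open>The coboundary\<close>

definition merge :: "nat \<Rightarrow> 'b::times list \<Rightarrow> 'b list"
  where "merge i as = take (i - 1) as @ [as ! (i - 1) * as ! i] @ drop (i + 1) as"

lemma merge_append: "length us + 1 = i \<Longrightarrow> merge i (us @ a # b # vs) = us @ (a * b) # vs"
  by (auto simp: merge_def nth_append)

lemma length_merge: "1 \<le> i \<Longrightarrow> i < length as \<Longrightarrow> length (merge i as) = length as - 1"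
  by (simp add: merge_def)

lemma split_at_pair:
  assumes "1 \<le> i" "i < length as"
  obtains us a b vs where "as = us @ a # b # vs" "length us + 1 = i"
proof
  show "as = take (i - 1) as @ as ! (i - 1) # as ! i # drop (i + 1) as"
    using assms by (metis One_nat_def Suc_diff_1 Suc_eq_plus1 Suc_leD Suc_le_eq Suc_le_lessD
      append_take_drop_id Cons_nth_drop_Suc less_imp_diff_less)
  show "length (take (i - 1) as) + 1 = i" using assms by simp
qed

text \<open>In each position of the varied entry \<open>a\<close> relative to the product, the merged list contains
  exactly one entry that depends on \<open>a\<close>, and does so linearly: it is \<open>a\<close>, \<open>u a\<close> or \<open>a u\<close>.\<close>

lemma merge_multi:
  fixes f :: "'b::complex_algebra_1 tensor \<Rightarrow> complex"
  assumes "clinear f" "1 \<le> i" "i < length xs + length ys + 1"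
  shows "f (pure (merge i (xs @ (a + b) # ys)))
      = f (pure (merge i (xs @ a # ys))) + f (pure (merge i (xs @ b # ys)))"
    and "f (pure (merge i (xs @ (c *\<^sub>C a) # ys))) = c * f (pure (merge i (xs @ a # ys)))"
proof -
  have "\<exists>us h vs. clinear h \<and> (\<forall>a. merge i (xs @ a # ys) = us @ h a # vs)"
  proof -
    have lin: "clinear (\<lambda>a. a)" "clinear (\<lambda>a. u * a)" "clinear (\<lambda>a. a * u)" for u :: 'b
      by (simp_all add: clinear_iff distrib_left distrib_right scaleC_mult_left scaleC_mult_right)
    consider "i < length xs" | "i = length xs" | "i = length xs + 1" | "i > length xs + 1" by linarith
    then show ?thesis
    proof cases
      case 1
      then have "merge i (xs @ a # ys) = merge i xs @ a # ys" for a
        by (simp add: merge_def nth_append less_imp_diff_less)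
      then show ?thesis using lin(1) by blast
    next
      case 2
      then have "merge i (xs @ a # ys) = take (i - 1) xs @ (xs ! (i - 1) * a) # ys" for a
        using assms(2) by (cases xs rule: rev_cases) (auto simp: merge_def nth_append)
      then show ?thesis using lin(2) by blast
    next
      case 3
      then have "merge i (xs @ a # ys) = xs @ (a * ys ! 0) # drop 1 ys" for a
        by (simp add: merge_def nth_append)
      then show ?thesis using lin(3) by blast
    next
      case 4
      then obtain k where "i = length xs + 1 + Suc k"
        using less_iff_Suc_add by auto
      then have "merge i (xs @ a # ys) = xs @ a # merge (Suc k) ys" for a
        by (simp add: merge_def nth_append numeral_3_eq_3)
      then show ?thesis using lin(1) by blast
    qed
  qed
  then obtain us h vs where h: "clinear h" and m: "\<And>a. merge i (xs @ a # ys) = us @ h a # vs"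
    by blast
  show "f (pure (merge i (xs @ (a + b) # ys)))
      = f (pure (merge i (xs @ a # ys))) + f (pure (merge i (xs @ b # ys)))"
    by (simp only: m clinear_add[OF h] pure_add clinear_add[OF assms(1)])
  show "f (pure (merge i (xs @ (c *\<^sub>C a) # ys))) = c * f (pure (merge i (xs @ a # ys)))"
    by (simp only: m clinear_scaleC[OF h] pure_scaleC clinear_scaleC[OF assms(1)] scaleC_complex_def)
qed

lemma coboundary_multi:
  fixes f :: "'a::complex_algebra_1 cochain"
  assumes "clinear \<delta>" "clinear f"
  shows "multi_semilinear id (\<lambda>as. if length as = n + 1 then
      \<delta> (hd as) * f (pure (tl as)) + (\<Sum>i=1..n. (-1) ^ i * f (pure (merge i as)))
      + (-1) ^ (n + 1) * f (pure (butlast as)) * \<delta> (last as) else 0)"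
proof (rule multi_semilinear_if_length)
  fix xs ys :: "'a list" and a b :: 'a and c
  assume n: "length xs + length ys + 1 = n + 1"
  have hd: "\<delta> (hd (xs @ (a + b) # ys)) * f (pure (tl (xs @ (a + b) # ys)))
      = \<delta> (hd (xs @ a # ys)) * f (pure (tl (xs @ a # ys)))
      + \<delta> (hd (xs @ b # ys)) * f (pure (tl (xs @ b # ys)))"
    "\<delta> (hd (xs @ (c *\<^sub>C a) # ys)) * f (pure (tl (xs @ (c *\<^sub>C a) # ys)))
      = c * (\<delta> (hd (xs @ a # ys)) * f (pure (tl (xs @ a # ys))))"
    using assms
    by (cases xs; simp add: clinear_iff pure_add pure_scaleC scaleC_complex_def algebra_simps)+
  have last: "f (pure (butlast (xs @ (a + b) # ys))) * \<delta> (last (xs @ (a + b) # ys))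
      = f (pure (butlast (xs @ a # ys))) * \<delta> (last (xs @ a # ys))
      + f (pure (butlast (xs @ b # ys))) * \<delta> (last (xs @ b # ys))"
    "f (pure (butlast (xs @ (c *\<^sub>C a) # ys))) * \<delta> (last (xs @ (c *\<^sub>C a) # ys))
      = c * (f (pure (butlast (xs @ a # ys))) * \<delta> (last (xs @ a # ys)))"
    using assms
    by (cases ys rule: rev_cases;
      simp add: clinear_iff pure_add pure_scaleC scaleC_complex_def algebra_simps butlast_append)+
  have mid: "(\<Sum>i=1..n. (-1) ^ i * f (pure (merge i (xs @ (a + b) # ys))))
      = (\<Sum>i=1..n. (-1) ^ i * f (pure (merge i (xs @ a # ys))))
      + (\<Sum>i=1..n. (-1) ^ i * f (pure (merge i (xs @ b # ys))))"
    "(\<Sum>i=1..n. (-1) ^ i * f (pure (merge i (xs @ (c *\<^sub>C a) # ys))))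
      = c * (\<Sum>i=1..n. (-1) ^ i * f (pure (merge i (xs @ a # ys))))"
    unfolding sum_distrib_left sum.distrib[symmetric] using n
    by (auto intro!: sum.cong simp: merge_multi[OF assms(2)] algebra_simps)
  show "\<delta> (hd (xs @ (a + b) # ys)) * f (pure (tl (xs @ (a + b) # ys)))
      + (\<Sum>i=1..n. (-1) ^ i * f (pure (merge i (xs @ (a + b) # ys))))
      + (-1) ^ (n + 1) * f (pure (butlast (xs @ (a + b) # ys))) * \<delta> (last (xs @ (a + b) # ys))
    = \<delta> (hd (xs @ a # ys)) * f (pure (tl (xs @ a # ys)))
      + (\<Sum>i=1..n. (-1) ^ i * f (pure (merge i (xs @ a # ys))))
      + (-1) ^ (n + 1) * f (pure (butlast (xs @ a # ys))) * \<delta> (last (xs @ a # ys))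
    + (\<delta> (hd (xs @ b # ys)) * f (pure (tl (xs @ b # ys)))
      + (\<Sum>i=1..n. (-1) ^ i * f (pure (merge i (xs @ b # ys))))
      + (-1) ^ (n + 1) * f (pure (butlast (xs @ b # ys))) * \<delta> (last (xs @ b # ys)))"
    unfolding hd mid mult.assoc last by (simp only: distrib_left add_ac)
  show "\<delta> (hd (xs @ (c *\<^sub>C a) # ys)) * f (pure (tl (xs @ (c *\<^sub>C a) # ys)))
      + (\<Sum>i=1..n. (-1) ^ i * f (pure (merge i (xs @ (c *\<^sub>C a) # ys))))
      + (-1) ^ (n + 1) * f (pure (butlast (xs @ (c *\<^sub>C a) # ys))) * \<delta> (last (xs @ (c *\<^sub>C a) # ys))
    = id c *\<^sub>C (\<delta> (hd (xs @ a # ys)) * f (pure (tl (xs @ a # ys)))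
      + (\<Sum>i=1..n. (-1) ^ i * f (pure (merge i (xs @ a # ys))))
      + (-1) ^ (n + 1) * f (pure (butlast (xs @ a # ys))) * \<delta> (last (xs @ a # ys)))"
    unfolding hd mid mult.assoc last id_apply scaleC_complex_def
    by (simp only: distrib_left mult.left_commute)
qed

lemma coboundary_clinear:
  assumes "clinear \<delta>" "clinear f"
  shows "clinear (coboundary \<delta> n f)"
  using semilift_clinear[OF coboundary_multi[OF assms]] by (simp only: coboundary_def merge_def)

lemma coboundary_pure:
  assumes "clinear \<delta>" "clinear f"
  shows "coboundary \<delta> n f (pure as) = (if length as = n + 1 then
      \<delta> (hd as) * f (pure (tl as)) + (\<Sum>i=1..n. (-1) ^ i * f (pure (merge i as)))
      + (-1) ^ (n + 1) * f (pure (butlast as)) * \<delta> (last as) else 0)"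
  using scalar_id.semilift_pure[OF coboundary_multi[OF assms]] by (simp only: coboundary_def merge_def)

lemma coboundary_scaleC:
  "coboundary \<delta> n (c *\<^sub>C f) = c *\<^sub>C coboundary \<delta> n f"
  unfolding coboundary_def fun_eq_iff scaleC_fun_def semilift_fun_scaleC[symmetric]
  by (intro allI arg_cong2[where f = tlift])
    (auto simp: fun_eq_iff scaleC_complex_def distrib_left right_diff_distrib sum_distrib_left mult_ac)

lemma cochains_clinear: "f \<in> cochains n \<Longrightarrow> clinear f"
  by (simp add: cochains_def)

lemma cochains_iff: "f \<in> cochains n \<longleftrightarrow> clinear f \<and> (\<forall>xs. length xs \<noteq> n \<longrightarrow> f (pure xs) = 0)"
proof -
  have "pure xs \<in> tpow (length xs)" for xs :: "'a list"
    by (auto simp: tpow_def intro!: complex_vector.span_base)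
  moreover have "f t = 0" if "clinear f" "\<forall>xs. length xs \<noteq> n \<longrightarrow> f (pure xs) = 0" "t \<in> tpow m" "m \<noteq> n"
    for t :: "'a tensor" and m
    by (rule clinear_eq_on_span[OF that(1), of "\<lambda>_. 0"])
      (use that in \<open>auto simp: tpow_def clinear_iff\<close>)
  ultimately show ?thesis unfolding cochains_def by blast
qed

lemma coboundary_cochains:
  "clinear \<delta> \<Longrightarrow> f \<in> cochains n \<Longrightarrow> coboundary \<delta> n f \<in> cochains (n + 1)"
  by (simp add: cochains_iff coboundary_clinear coboundary_pure)

lemma subspace_iff: "complex_vector.subspace S \<longleftrightarrow>
    0 \<in> S \<and> (\<forall>x\<in>S. \<forall>y\<in>S. x + y \<in> S) \<and> (\<forall>c. \<forall>x\<in>S. c *\<^sub>C x \<in> S)"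
  by (simp add: complex_vector.subspace_def)

lemma cochains_subspace: "complex_vector.subspace (cochains n)"
  by (auto simp: subspace_iff cochains_iff clinear_iff scaleC_fun_def algebra_simps
      scaleC_complex_def)

section \<open>Convolution with the multiplication\<close>

text \<open>This is \<open>f \<star> \<mu>\<^sup>(\<^sup>n\<^sup>)\<close> when \<open>L\<close> lists the legs of \<open>\<Delta>\<close>, and \<open>\<mu>\<^sup>(\<^sup>n\<^sup>) \<star> f\<close> when it lists them in exchanged order,
  because scalars commute with the elements of \<open>'b\<close>.\<close>

definition conv_mu ::
    "('b \<Rightarrow> ('b \<times> 'b) list) \<Rightarrow> 'b::complex_algebra_1 cochain \<Rightarrow> 'b list \<Rightarrow> 'b"
  where "conv_mu L f as = sweedler_sum L as (\<lambda>xs ys. f (pure xs) *\<^sub>C prod_list ys)"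

lemma conv_mu_add: "conv_mu L (f + g) as = conv_mu L f as + conv_mu L g as"
  by (simp add: conv_mu_def scaleC_add_left sweedler_sum_add)

lemma conv_mu_scaleC: "conv_mu L (c *\<^sub>C f) as = c *\<^sub>C conv_mu L f as"
  unfolding conv_mu_def sweedler_sum_scaleC[symmetric]
  by (simp add: scaleC_fun_def scaleC_complex_def scaleC_scaleC)

lemma conv_mu_zero: "conv_mu L 0 as = 0"
  by (simp add: conv_mu_def sweedler_sum_zero)

text \<open>What the argument uses of the comultiplication, in a form that holds for \<open>\<Delta>\<close> as well as for the opposite
  comultiplication; in this way the two convolutions are treated by one computation.\<close>

locale bialgebra_legs =
  fixes \<delta> :: "'b::complex_algebra_1 \<Rightarrow> complex" and L :: "'b \<Rightarrow> ('b \<times> 'b) list"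
  assumes counit_linear: "clinear \<delta>"
    and counit: "(\<Sum>(x, y)\<leftarrow>L a. \<delta> x *\<^sub>C y) = a"
    and mult: "cbilinear (\<beta> :: 'b \<Rightarrow> 'b \<Rightarrow> 'b) \<Longrightarrow> (\<Sum>(x, y)\<leftarrow>L (a * b). \<beta> x y)
      = (\<Sum>(x, y)\<leftarrow>L a. \<Sum>(x', y')\<leftarrow>L b. \<beta> (x * x') (y * y'))"
begin

text \<open>The counit law collapses the sum over the legs of the first argument to that argument, which
  is left standing as a left factor; likewise for the last argument below.\<close>

lemma conv_mu_first:
  "sweedler_sum L (a # as) (\<lambda>xs ys. (\<delta> (hd xs) * f (pure (tl xs))) *\<^sub>C prod_list ys)
    = a * conv_mu L f as"
proof -
  have "sweedler_sum L as (\<lambda>xs ys. (\<delta> x * f (pure xs)) *\<^sub>C (y * prod_list ys))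
      = (\<delta> x *\<^sub>C y) * conv_mu L f as" for x y
  proof -
    have "clinear (\<lambda>z. (\<delta> x *\<^sub>C y) * z)"
      by (simp add: clinear_iff distrib_left scaleC_mult_right)
    note lin = this
    show ?thesis
      unfolding conv_mu_def sweedler_sum_linear[OF lin]
      by (simp add: scaleC_mult_left scaleC_mult_right scaleC_scaleC mult.commute)
  qed
  then have "sweedler_sum L (a # as) (\<lambda>xs ys. (\<delta> (hd xs) * f (pure (tl xs))) *\<^sub>C prod_list ys)
      = (\<Sum>(x, y)\<leftarrow>L a. (\<delta> x *\<^sub>C y) * conv_mu L f as)"
    by simp
  also have "\<dots> = (\<Sum>(x, y)\<leftarrow>L a. \<delta> x *\<^sub>C y) * conv_mu L f as"
    by (simp add: sum_list_mult_const case_prod_unfold)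
  finally show ?thesis by (simp only: counit)
qed

lemma conv_mu_last:
  "sweedler_sum L (as @ [a]) (\<lambda>xs ys. (f (pure (butlast xs)) * \<delta> (last xs)) *\<^sub>C prod_list ys)
    = conv_mu L f as * a"
proof -
  have "(\<Sum>(x, y)\<leftarrow>L a. (f (pure xs) * \<delta> x) *\<^sub>C (prod_list ys * y)) = f (pure xs) *\<^sub>C prod_list ys * a"
    for xs ys
  proof -
    have "clinear (\<lambda>z. f (pure xs) *\<^sub>C prod_list ys * z)"
      by (simp add: clinear_iff distrib_left scaleC_mult_right)
    from clinear_sum_list[OF this, of "\<lambda>(x, y). \<delta> x *\<^sub>C y" "L a"] show ?thesis
      by (simp add: counit[unfolded case_prod_unfold] case_prod_unfold scaleC_mult_left scaleC_mult_right scaleC_scaleC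
          mult.commute)
  qed
  moreover have "clinear (\<lambda>z. z * a)"
    by (simp add: clinear_iff distrib_right scaleC_mult_left)
  ultimately show ?thesis
    unfolding conv_mu_def sweedler_sum_append
    by (simp add: sweedler_sum_linear[of "\<lambda>z. z * a"])
qed

text \<open>Since \<open>\<Delta>(a b) = \<Delta> a \<Delta> b\<close>, multiplying two neighbouring first legs, while the second legs are multiplied
  together anyway, amounts to taking the legs of \<open>a b\<close>.\<close>

lemma conv_mu_merge:
  assumes "clinear f" "1 \<le> i" "i < length as"
  shows "sweedler_sum L as (\<lambda>xs ys. f (pure (merge i xs)) *\<^sub>C prod_list ys) = conv_mu L f (merge i as)"
proof -
  obtain us a b vs where as: "as = us @ a # b # vs" and i: "length us + 1 = i"
    using split_at_pair[OF assms(2,3)] .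
  \<comment> \<open>The dependence of the whole expression on one pair of legs, with those to its left fixed.\<close>
  define \<beta> where "\<beta> xs ys x y =
      sweedler_sum L vs (\<lambda>xs' ys'. f (pure (xs @ x # xs')) *\<^sub>C prod_list (ys @ y # ys'))"
    for xs ys x y
  have "cbilinear (\<beta> xs ys)" for xs ys
    unfolding cbilinear_iff \<beta>_def sweedler_sum_add[symmetric] sweedler_sum_scaleC[symmetric]
    by (simp add: pure_add pure_scaleC clinear_add[OF assms(1)] clinear_scaleC[OF assms(1)]
        scaleC_add_left scaleC_add_right distrib_left distrib_right scaleC_mult_left
        scaleC_mult_right scaleC_complex_def scaleC_scaleC mult.commute)
  note mult' = mult[OF this]
  have "sweedler_sum L as (\<lambda>xs ys. f (pure (merge i xs)) *\<^sub>C prod_list ys)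
      = sweedler_sum L us (\<lambda>xs ys. \<Sum>(x, y)\<leftarrow>L a. \<Sum>(x', y')\<leftarrow>L b. \<beta> xs ys (x * x') (y * y'))"
    unfolding as sweedler_sum_append \<beta>_def
    by (rule sweedler_sum_cong) (simp add: merge_append i[symmetric] mult.assoc)
  also have "\<dots> = conv_mu L f (us @ (a * b) # vs)"
    by (simp add: conv_mu_def sweedler_sum_append flip: mult') (simp add: \<beta>_def)
  finally show ?thesis by (simp only: as merge_append[OF i])
qed

text \<open>Convolution with the multiplication replaces the trivial bimodule \<open>\<complex>\<close>, on which \<open>'b\<close> acts through \<open>\<delta>\<close>,
  by the bimodule \<open>'b\<close>.\<close>

lemma conv_mu_coboundary:
  assumes "clinear f" "length as = n + 1"
  shows "conv_mu L (coboundary \<delta> n f) as = hd as * conv_mu L f (tl as)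
    + (\<Sum>i=1..n. (-1) ^ i *\<^sub>C conv_mu L f (merge i as))
    + (-1) ^ (n + 1) *\<^sub>C (conv_mu L f (butlast as) * last as)"
proof -
  have "as \<noteq> []" using assms(2) by auto
  have "conv_mu L (coboundary \<delta> n f) as =
      sweedler_sum L as (\<lambda>xs ys. (\<delta> (hd xs) * f (pure (tl xs))) *\<^sub>C prod_list ys
        + (\<Sum>i=1..n. (-1) ^ i *\<^sub>C f (pure (merge i xs)) *\<^sub>C prod_list ys)
        + (-1) ^ (n + 1) *\<^sub>C (f (pure (butlast xs)) * \<delta> (last xs)) *\<^sub>C prod_list ys)"
    unfolding conv_mu_def
    by (rule sweedler_sum_cong)
      (simp add: coboundary_pure[OF counit_linear assms(1)] assms(2) scaleC_add_left
        complex_vector.scale_left_diff_distrib complex_vector.scale_sum_left scaleC_scaleC mult.assoc)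
  also have "\<dots> = hd as * conv_mu L f (tl as)
      + (\<Sum>i=1..n. (-1) ^ i *\<^sub>C conv_mu L f (merge i as))
      + (-1) ^ (n + 1) *\<^sub>C (conv_mu L f (butlast as) * last as)"
    unfolding sweedler_sum_add sweedler_sum_sum sweedler_sum_scaleC
    using conv_mu_first[of "hd as" "tl as"] conv_mu_last[of "butlast as" "last as"] \<open>as \<noteq> []\<close> assms
    by (simp add: conv_mu_merge)
  finally show ?thesis .
qed

end

section \<open>Commuting and normalized cochains\<close>

context bialgebra
begin

lemma bialgebra_legs: "bialgebra_legs \<delta> (legs \<Delta>)"
  by (rule bialgebra_legs.intro) (simp_all only: counit_linear legs_counit_left legs_mult)

text \<open>The right counit law now plays the role of the left one.\<close>

lemma bialgebra_legs_swap: "bialgebra_legs \<delta> (map prod.swap \<circ> legs \<Delta>)"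
proof (rule bialgebra_legs.intro)
  show "clinear \<delta>" by (rule counit_linear)
  show "(\<Sum>(x, y)\<leftarrow>(map prod.swap \<circ> legs \<Delta>) a. \<delta> x *\<^sub>C y) = a" for a
    using legs_counit_right[of a] by (simp add: case_prod_unfold comp_def)
  fix \<beta> :: "'b \<Rightarrow> 'b \<Rightarrow> 'b" and a b
  assume "cbilinear \<beta>"
  then have "cbilinear (\<lambda>x y. \<beta> y x)" by (simp add: cbilinear_def)
  from legs_mult[OF this, of a b]
  show "(\<Sum>(x, y)\<leftarrow>(map prod.swap \<circ> legs \<Delta>) (a * b). \<beta> x y) =
      (\<Sum>(x, y)\<leftarrow>(map prod.swap \<circ> legs \<Delta>) a. \<Sum>(x', y')\<leftarrow>(map prod.swap \<circ> legs \<Delta>) b. \<beta> (x * x') (y * y'))"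
    by (simp add: case_prod_unfold comp_def)
qed

lemma cochains_C_iff: "f \<in> cochains_C \<Delta> n \<longleftrightarrow> f \<in> cochains n \<and>
    (\<forall>as. length as = n \<longrightarrow> conv_mu (legs \<Delta>) f as = conv_mu (map prod.swap \<circ> legs \<Delta>) f as)"
proof (cases "f \<in> cochains n")
  case True
  then have f: "clinear f" by (rule cochains_clinear)
  have mu: "clinear (tensor_mu :: 'b tensor \<Rightarrow> 'b)"
    unfolding tensor_mu_def by (rule semilift_clinear[OF prod_list_multi])
  have \<beta>: "cbilinear (\<lambda>c (b::'b). c *\<^sub>C b)" "cbilinear (\<lambda>(b::'b) c. c *\<^sub>C b)"
    by (simp_all add: cbilinear_iff scaleC_add_left scaleC_add_right scaleC_scaleC
        scaleC_complex_def mult.commute)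
  let ?l = "convolution \<Delta> n (\<lambda>c b. c *\<^sub>C b) f tensor_mu"
  let ?r = "convolution \<Delta> n (\<lambda>b c. c *\<^sub>C b) tensor_mu f"
  have l: "?l (pure as) = conv_mu (legs \<Delta>) f as"
    and r: "?r (pure as) = conv_mu (map prod.swap \<circ> legs \<Delta>) f as" if "length as = n" for as
    using that by (simp_all add: convolution_pure \<beta> f mu conv_mu_def sweedler_sum_swap tensor_mu_pure)
  have "(\<forall>t\<in>tpow n. ?l t = ?r t) \<longleftrightarrow> (\<forall>as. length as = n \<longrightarrow> ?l (pure as) = ?r (pure as))"
  proof
    assume *: "\<forall>as. length as = n \<longrightarrow> ?l (pure as) = ?r (pure as)"
    show "\<forall>t\<in>tpow n. ?l t = ?r t"
    proof
      fix t :: "'b tensor"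
      assume "t \<in> tpow n"
      then show "?l t = ?r t"
        unfolding tpow_def
        by (rule clinear_eq_on_span[rotated 3])
          (use * in \<open>auto intro!: convolution_clinear \<beta> f mu\<close>)
    qed
  qed (auto simp: tpow_def intro!: complex_vector.span_base)
  with True l r show ?thesis by (simp add: cochains_C_def)
qed (simp add: cochains_C_def)

text \<open>The formula for \<open>\<partial>f \<star> \<mu>\<close> and that for \<open>\<mu> \<star> \<partial>f\<close> differ only in the convolutions of \<open>f\<close> on their
  right-hand sides, which agree by assumption.\<close>

lemma subcomplex_C: "subcomplex scaleC \<delta> (cochains_C \<Delta>)"
  unfolding subcomplex_def
proof (intro allI conjI)
  fix n
  show "cochains_C \<Delta> n \<subseteq> cochains n"
    by (auto simp: cochains_C_iff)
  show "complex_vector.subspace (cochains_C \<Delta> n)"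
    using cochains_subspace[of n]
    by (auto simp: subspace_iff cochains_C_iff conv_mu_add conv_mu_scaleC conv_mu_zero)
  show "coboundary \<delta> n ` cochains_C \<Delta> n \<subseteq> cochains_C \<Delta> (n + 1)"
  proof (intro image_subsetI)
    fix f
    assume "f \<in> cochains_C \<Delta> n"
    then have f: "f \<in> cochains n"
      and C: "\<And>as. length as = n \<Longrightarrow> conv_mu (legs \<Delta>) f as = conv_mu (map prod.swap \<circ> legs \<Delta>) f as"
      by (auto simp: cochains_C_iff)
    show "coboundary \<delta> n f \<in> cochains_C \<Delta> (n + 1)"
      unfolding cochains_C_iff
    proof (intro conjI allI impI)
      show "coboundary \<delta> n f \<in> cochains (n + 1)"
        by (rule coboundary_cochains[OF counit_linear f])
      fix as :: "'b list"
      assume as: "length as = n + 1"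
      show "conv_mu (legs \<Delta>) (coboundary \<delta> n f) as
          = conv_mu (map prod.swap \<circ> legs \<Delta>) (coboundary \<delta> n f) as"
        unfolding bialgebra_legs.conv_mu_coboundary[OF bialgebra_legs cochains_clinear[OF f] as]
          bialgebra_legs.conv_mu_coboundary[OF bialgebra_legs_swap cochains_clinear[OF f] as]
        by (simp add: C length_merge as)
    qed
  qed
qed

lemma subcomplex_N: "subcomplex scaleC \<delta> cochains_N"
  unfolding subcomplex_def
proof (intro allI conjI)
  fix n
  show "(cochains_N n :: 'b cochain set) \<subseteq> cochains n"
    by (auto simp: cochains_N_def)
  show "complex_vector.subspace (cochains_N n :: 'b cochain set)"
    using cochains_subspace[of n]
    by (auto simp: subspace_iff cochains_N_def scaleC_fun_def scaleC_complex_def)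
  have "merge i (replicate (n + 1) (1::'b)) = replicate n 1" if "1 \<le> i" "i \<le> n" for i
    by (rule nth_equalityI) (use that in \<open>auto simp: merge_def nth_append min_def nth_Cons'\<close>)
  moreover have "butlast (1 # replicate n (1::'b)) = replicate n 1"
    by (cases n) (simp_all flip: replicate_append_same)
  ultimately show "coboundary \<delta> n ` cochains_N n \<subseteq> cochains_N (n + 1)"
    by (auto simp: cochains_N_def coboundary_cochains[OF counit_linear, simplified]
        coboundary_pure[OF counit_linear cochains_clinear])
qed

end

section \<open>Hermitian cochains\<close>

lemma sign_step: "(if odd \<lceil>real (n + 1) / 2\<rceil> then 1 else - 1 :: complex)
    = (- 1) ^ (n + 1) * (if odd \<lceil>real n / 2\<rceil> then 1 else - 1)"
proof (cases "even n")
  case True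
  then obtain k where "n = 2 * k" by (elim evenE)
  moreover have "\<lceil>real (2 * k + 1) / 2\<rceil> = int k + 1" by (simp add: ceiling_eq_iff)
  ultimately show ?thesis by simp
next
  case False
  then obtain k where "n = 2 * k + 1" by (elim oddE)
  moreover have "\<lceil>real (2 * k + 1) / 2\<rceil> = int k + 1" "\<lceil>real (2 * k + 1 + 1) / 2\<rceil> = int k + 1"
    by (simp_all add: ceiling_eq_iff)
  ultimately show ?thesis by simp
qed

lemma merge_rev:
  assumes "length as = n + 1" "1 \<le> i" "i \<le> n" "\<And>a b. s (a * b) = s b * s a"
  shows "merge i (map s (rev as)) = map s (rev (merge (n + 1 - i) as))"
proof -
  obtain us a b vs where as: "as = us @ a # b # vs" and us: "length us + 1 = n + 1 - i"
    by (rule split_at_pair[of "n + 1 - i" as]) (use assms(1-3) in auto)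
  then have vs: "length (map s (rev vs)) + 1 = i" using assms(1-3) by auto
  show ?thesis
    using merge_append[OF vs, of "s b" "s a" "map s (rev us)"] merge_append[OF us, of a b vs]
    by (simp add: as assms(4))
qed

context star_bialgebra
begin

lemma tilde_multi:
  assumes "clinear f"
  shows "multi_semilinear id (\<lambda>as. cnj (f (pure (map star (rev as)))))"
  by (simp add: multi_semilinear_def star_add star_scaleC pure_add pure_scaleC
      clinear_add[OF assms] clinear_scaleC[OF assms] scaleC_complex_def)

lemma tilde_pure: "clinear f \<Longrightarrow> cochain_tilde star f (pure as) = cnj (f (pure (map star (rev as))))"
  by (simp add: cochain_tilde_def scalar_id.semilift_pure[OF tilde_multi])

lemma tilde_clinear: "clinear f \<Longrightarrow> clinear (cochain_tilde star f)"
  unfolding cochain_tilde_def by (rule semilift_clinear[OF tilde_multi])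

text \<open>The involution reverses the arguments, so the two outer terms change places and the \<open>i\<close>-th
  inner term becomes the \<open>(n + 1 - i)\<close>-th; since \<open>(-1)\<^sup>n\<^sup>+\<^sup>1\<^sup>-\<^sup>i = (-1)\<^sup>n\<^sup>+\<^sup>1 (-1)\<^sup>i\<close>, each of these exchanges
  costs the same factor \<open>(-1)\<^sup>n\<^sup>+\<^sup>1\<close>.\<close>

lemma tilde_coboundary:
  assumes "clinear f"
  shows "cochain_tilde star (coboundary \<delta> n f) = (- 1) ^ (n + 1) *\<^sub>C coboundary \<delta> n (cochain_tilde star f)"
proof (rule clinear_eqI)
  note lin = counit_linear assms coboundary_clinear[OF counit_linear assms]
    coboundary_clinear[OF counit_linear tilde_clinear[OF assms]] tilde_clinear
  show "clinear (cochain_tilde star (coboundary \<delta> n f))" by (intro lin)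
  show "clinear ((- 1) ^ (n + 1) *\<^sub>C coboundary \<delta> n (cochain_tilde star f))"
    using lin(4)[of n] by (simp only: clinear_iff scaleC_fun_def scaleC_add_right scaleC_scaleC mult.commute) simp
  fix as :: "'b list"
  show "cochain_tilde star (coboundary \<delta> n f) (pure as)
      = ((- 1) ^ (n + 1) *\<^sub>C coboundary \<delta> n (cochain_tilde star f)) (pure as)"
  proof (cases "length as = n + 1")
    case True
    then have "as \<noteq> []" by auto
    have rev_last: "hd (map star (rev as)) = star (last as)" "tl (map star (rev as)) = map star (rev (butlast as))"
      using \<open>as \<noteq> []\<close> by (cases as rule: rev_cases; simp)+
    have rev_hd: "last (map star (rev as)) = star (hd as)"
      "butlast (map star (rev as)) = map star (rev (tl as))"
      using \<open>as \<noteq> []\<close> by (cases as; simp)+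
    have "(\<Sum>i=1..n. (- 1) ^ i * cnj (f (pure (merge i (map star (rev as))))))
        = (\<Sum>i=1..n. (- 1) ^ i * cnj (f (pure (map star (rev (merge (n + 1 - i) as))))))"
      using True by (intro sum.cong) (auto simp: merge_rev star_mult)
    also have "\<dots> = (\<Sum>i=1..n. (- 1) ^ (n + 1 - i) * cnj (f (pure (map star (rev (merge i as))))))"
      by (rule sum.reindex_bij_witness[of _ "\<lambda>i. n + 1 - i" "\<lambda>i. n + 1 - i"]) auto
    also have "\<dots> = (- 1) ^ (n + 1) * (\<Sum>i=1..n. (- 1) ^ i * cnj (f (pure (map star (rev (merge i as))))))"
      unfolding sum_distrib_left mult.assoc[symmetric] power_add[symmetric]
      by (intro sum.cong arg_cong2[where f = "(*)"] refl) (auto simp: minus_one_power_iff)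
    finally have mid: "(\<Sum>i=1..n. (- 1) ^ i * cnj (f (pure (merge i (map star (rev as))))))
      = (- 1) ^ (n + 1) * (\<Sum>i=1..n. (- 1) ^ i * cnj (f (pure (map star (rev (merge i as))))))" .
    have sq: "(- 1) ^ (n + 1) * ((- 1) ^ (n + 1) * z) = z" for z :: complex
      by (simp add: mult.assoc[symmetric] power_add[symmetric] minus_one_power_iff)
    have "cochain_tilde star (coboundary \<delta> n f) (pure as)
        = \<delta> (last as) * cnj (f (pure (map star (rev (butlast as)))))
        + (- 1) ^ (n + 1) * (\<Sum>i=1..n. (- 1) ^ i * cnj (f (pure (map star (rev (merge i as))))))
        + (- 1) ^ (n + 1) * (cnj (f (pure (map star (rev (tl as))))) * \<delta> (hd as))"
      unfolding mid[symmetric]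
      by (simp add: tilde_pure lin coboundary_pure True rev_last rev_hd counit_star mult.assoc
          del: power_Suc)
    also have "\<dots> = (- 1) ^ (n + 1) * (\<delta> (hd as) * cnj (f (pure (map star (rev (tl as)))))
        + (\<Sum>i=1..n. (- 1) ^ i * cnj (f (pure (map star (rev (merge i as))))))
        + (- 1) ^ (n + 1) * (cnj (f (pure (map star (rev (butlast as))))) * \<delta> (last as)))"
      unfolding distrib_left sq by (simp only: add_ac mult.commute)
    also have "\<dots> = ((- 1) ^ (n + 1) *\<^sub>C coboundary \<delta> n (cochain_tilde star f)) (pure as)"
      by (simp add: tilde_pure lin coboundary_pure True scaleC_fun_def scaleC_complex_def mult.assoc
          del: power_Suc)
    finally show ?thesis .
  qed (simp add: tilde_pure lin coboundary_pure scaleC_fun_def scaleC_complex_def)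
qed

lemma cochains_H_iff: "f \<in> cochains_H star n \<longleftrightarrow> f \<in> cochains n \<and>
    cochain_tilde star f = (if odd \<lceil>real n / 2\<rceil> then 1 else - 1 :: complex) *\<^sub>C f"
  by (auto simp: cochains_H_def scaleC_one)

lemma tilde_add: "cochain_tilde star (f + g) = cochain_tilde star f + cochain_tilde star g"
  and tilde_scaleC: "cochain_tilde star (c *\<^sub>C f) = cnj c *\<^sub>C cochain_tilde star f"
  and tilde_zero: "cochain_tilde star 0 = 0"
  unfolding cochain_tilde_def fun_eq_iff plus_fun_apply zero_fun_apply scaleC_fun_def
    semilift_fun_add[symmetric] semilift_fun_scaleC[symmetric]
  by (simp_all add: scaleC_complex_def semilift_fun_zero)

lemma subcomplex_H: "subcomplex (\<lambda>r::real. scaleC (complex_of_real r)) \<delta> (cochains_H star)"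
  unfolding subcomplex_def
proof (intro allI conjI)
  fix n
  show "cochains_H star n \<subseteq> cochains n"
    by (auto simp: cochains_H_def)
  have "module (\<lambda>r::real. (*\<^sub>C) (complex_of_real r) :: 'b cochain \<Rightarrow> 'b cochain)"
    by unfold_locales (simp_all add: scaleC_add_left scaleC_add_right scaleC_scaleC scaleC_one)
  then show "module.subspace (\<lambda>r::real. (*\<^sub>C) (complex_of_real r)) (cochains_H star n)"
    using cochains_subspace[of n]
    by (auto simp: module.subspace_def subspace_iff cochains_H_iff tilde_add tilde_scaleC tilde_zero
        scaleC_add_right scaleC_scaleC mult.commute)
  show "coboundary \<delta> n ` cochains_H star n \<subseteq> cochains_H star (n + 1)"
  proof (intro image_subsetI)
    fix f
    assume "f \<in> cochains_H star n"
    then have f: "f \<in> cochains n"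
      and H: "cochain_tilde star f = (if odd \<lceil>real n / 2\<rceil> then 1 else - 1 :: complex) *\<^sub>C f"
      by (simp_all only: cochains_H_iff)
    show "coboundary \<delta> n f \<in> cochains_H star (n + 1)"
      unfolding cochains_H_iff sign_step tilde_coboundary[OF cochains_clinear[OF f]] H
        coboundary_scaleC scaleC_scaleC
      by (intro conjI coboundary_cochains[OF counit_linear f] refl)
  qed
qed

end

theorem mainTheorem7:
  fixes \<Delta> :: "'b::complex_algebra_1 \<Rightarrow> 'b tensor" and \<delta> :: "'b \<Rightarrow> complex"
  assumes "bialgebra \<Delta> \<delta>"
  shows "subcomplex scaleC \<delta> cochains_N
       \<and> subcomplex scaleC \<delta> (cochains_C \<Delta>)
       \<and> (\<forall>star. star_bialgebra \<Delta> \<delta> star \<longrightarrow>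
            subcomplex (\<lambda>r::real. scaleC (complex_of_real r)) \<delta> (cochains_H star))"
  using bialgebra.subcomplex_N[OF assms] bialgebra.subcomplex_C[OF assms]
    star_bialgebra.subcomplex_H
  by blast

end
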